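(* For every $n\in\mathbb{N}$, there exists a convex geometric graph with $n$ vertices and $O(n^{3/2})$ edges that is universal for $\mathcal{O}_2(n)$.
   Context: A geometric graph is a graph together with a straight-line drawing in the plane in which the vertices are distinct points and the edges are straight-line segments not containing any vertex in their interiors; it is convex if its vertices are in convex position. An embedding of an abstract graph $H$ into a geometric graph $G$ is an injective map $\phi:V(H)\to V(G)$ such that every edge $uv$ of $H$ is mapped to a segment $\phi(u)\phi(v)$ that is an edge of $G$, and any two edges of $H$ are mapped to non-crossing segments. A geometric graph is universal for a class $\mathcal H$ if it contains an embedding of every graph in $\mathcal H$. $\mathcal{O}_2(n)$ denotes the family of all outerplanar graphs on $n$ vertices that consist of a spanning (Hamiltonian) cycle plus $2$ vertex-disjoint chords. *)

theory Defs
  imports "HOL-Analysis.Analysis" "HOL-Library.Landau_Symbols"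
begin

record 'a ugraph =
  verts :: "'a set"
  edges :: "'a set set"

definition simple_graph :: "'a ugraph \<Rightarrow> bool" where
  "simple_graph H \<longleftrightarrow>
     finite (verts H) \<and> (\<forall>e\<in>edges H. e \<subseteq> verts H \<and> card e = 2)"

text \<open>
  The plane is represented by \<^typ>\<open>complex\<close>, for which the Jordan curve theorem is available.
  Since the vertices of a geometric graph are drawn as distinct points, a geometric graph is
  identified with its drawing: the vertices are points, and the edge \<open>{u, v}\<close> is drawn as the
  segment between \<open>u\<close> and \<open>v\<close>.
\<close>

definition geometric_graph :: "complex ugraph \<Rightarrow> bool" where
  "geometric_graph G \<longleftrightarrow> simple_graph G \<and>
     (\<forall>u v w. {u, v} \<in> edges G \<and> w \<in> verts G \<longrightarrow> w \<notin> open_segment u v)"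

definition convex_position :: "complex set \<Rightarrow> bool" where
  "convex_position P \<longleftrightarrow> (\<forall>x\<in>P. x \<notin> convex hull (P - {x}))"

definition convex_geometric_graph :: "complex ugraph \<Rightarrow> bool" where
  "convex_geometric_graph G \<longleftrightarrow> geometric_graph G \<and> convex_position (verts G)"

text \<open>
  Two edges cross if their relative interiors meet. In a geometric graph no vertex lies in the
  interior of an edge, so any common point of two distinct edges that is not a common endpoint is
  interior to both.
\<close>

definition segments_cross :: "complex \<Rightarrow> complex \<Rightarrow> complex \<Rightarrow> complex \<Rightarrow> bool" where
  "segments_cross a b c d \<longleftrightarrow> open_segment a b \<inter> open_segment c d \<noteq> {}"

definition graph_embedding :: "('a \<Rightarrow> complex) \<Rightarrow> 'a ugraph \<Rightarrow> complex ugraph \<Rightarrow> bool" where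
  "graph_embedding \<phi> H G \<longleftrightarrow>
     inj_on \<phi> (verts H) \<and> \<phi> ` verts H \<subseteq> verts G \<and>
     (\<forall>u v. {u, v} \<in> edges H \<longrightarrow> {\<phi> u, \<phi> v} \<in> edges G) \<and>
     (\<forall>u v x y. {u, v} \<in> edges H \<and> {x, y} \<in> edges H \<and> {u, v} \<noteq> {x, y} \<longrightarrow>
        \<not> segments_cross (\<phi> u) (\<phi> v) (\<phi> x) (\<phi> y))"

definition universal_for :: "complex ugraph \<Rightarrow> 'a ugraph set \<Rightarrow> bool" where
  "universal_for G \<H> \<longleftrightarrow> (\<forall>H\<in>\<H>. \<exists>\<phi>. graph_embedding \<phi> H G)"

text \<open>
  A plane drawing maps the vertices to points by \<open>p\<close> and the edges to simple arcs by \<open>\<gamma>\<close>; two arcs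
  may meet only at the images of common endpoints.
\<close>

definition plane_drawing ::
    "'a ugraph \<Rightarrow> ('a \<Rightarrow> complex) \<Rightarrow> ('a set \<Rightarrow> real \<Rightarrow> complex) \<Rightarrow> bool" where
  "plane_drawing H p \<gamma> \<longleftrightarrow>
     inj_on p (verts H) \<and>
     (\<forall>e\<in>edges H. arc (\<gamma> e) \<and> {pathstart (\<gamma> e), pathfinish (\<gamma> e)} = p ` e \<and>
        path_image (\<gamma> e) \<inter> p ` verts H = p ` e) \<and>
     (\<forall>e\<in>edges H. \<forall>f\<in>edges H. e \<noteq> f \<longrightarrow>
        path_image (\<gamma> e) \<inter> path_image (\<gamma> f) \<subseteq> p ` (e \<inter> f))"

definition drawing_image ::
    "'a ugraph \<Rightarrow> ('a \<Rightarrow> complex) \<Rightarrow> ('a set \<Rightarrow> real \<Rightarrow> complex) \<Rightarrow> complex set" where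
  "drawing_image H p \<gamma> = p ` verts H \<union> (\<Union>e\<in>edges H. path_image (\<gamma> e))"

text \<open>
  The drawing of a finite graph is compact, so \<^const>\<open>outside\<close> of it is the unique unbounded
  component of its complement, i.e. the outer face.
\<close>

definition outerplanar :: "'a ugraph \<Rightarrow> bool" where
  "outerplanar H \<longleftrightarrow> simple_graph H \<and>
     (\<exists>p \<gamma>. plane_drawing H p \<gamma> \<and>
        (\<forall>v\<in>verts H. p v \<in> frontier (outside (drawing_image H p \<gamma>))))"

definition cycle_edges :: "'a list \<Rightarrow> 'a set set" where
  "cycle_edges c = {{c ! i, c ! (Suc i mod length c)} | i. i < length c}"

definition spanning_cycle :: "'a ugraph \<Rightarrow> 'a list \<Rightarrow> bool" where
  "spanning_cycle H c \<longleftrightarrow>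
     distinct c \<and> 3 \<le> length c \<and> set c = verts H \<and> cycle_edges c \<subseteq> edges H"

definition chord :: "'a ugraph \<Rightarrow> 'a list \<Rightarrow> 'a set \<Rightarrow> bool" where
  "chord H c e \<longleftrightarrow> e \<in> edges H \<and> e \<notin> cycle_edges c"

text \<open>
  Every finite graph is isomorphic to one whose vertices are natural numbers, so fixing this
  vertex type (with an arbitrary set of \<open>n\<close> numbers as vertices) loses no graph.
\<close>

definition outerplanar_two_chords :: "nat \<Rightarrow> nat ugraph set" where
  "outerplanar_two_chords n =
     {H. outerplanar H \<and> card (verts H) = n \<and>
        (\<exists>c e f. spanning_cycle H c \<and> chord H c e \<and> chord H c f \<and> e \<inter> f = {} \<and>
           edges H = cycle_edges c \<union> {e, f})}"

end

theory Submission
  imports Defs "HOL-Library.Discrete_Functions"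
begin

text \<open>
  Take \<open>n\<close> points on the unit circle, the edges of their convex hull, and every edge incident to a
  set \<open>S\<close> of \<open>O(sqrt n)\<close> of the points whose index differences cover all residues modulo \<open>n\<close>;
  this makes \<open>O(n powr (3 / 2))\<close> edges. Given a Hamiltonian cycle with two disjoint chords, choose
  an endpoint of each chord. Some rotation of the cycle puts both endpoints into \<open>S\<close>, so both chords
  become edges.

  It remains to see that the chords do not cross in this drawing, i.e. that their ends do not
  interleave on the cycle. Otherwise the graph is a subdivision of \<open>K\<^sub>4\<close>, and such a graph is not
  outerplanar: in a drawing with all vertices on the outer face both chords would run inside the
  cycle, where one separates the ends of the other.
\<close>

subsection \<open>Theta curves\<close>

text \<open>Injectivity keeps the value at parameter 1/2 apart from both end values; this gives a
  witness that an arc is more than its two ends.\<close>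

lemma arc_midpoint_not_end:
  assumes "arc g"
  shows "g (1/2) \<in> path_image g - {pathstart g, pathfinish g}"
proof -
  have "inj_on g {0..1}" using assms by (simp add: arc_def)
  then show ?thesis
    using inj_onD[of g "{0..1}" "1/2" 0] inj_onD[of g "{0..1}" "1/2" 1]
    by (auto simp: path_image_def pathstart_def pathfinish_def)
qed

lemma inside_imp_notin: "x \<in> inside S \<Longrightarrow> x \<notin> S"
  using inside_no_overlap by blast

text \<open>By injectivity, deleting the start point deletes exactly the parameter 0, so what
  remains is a continuous image of \<open>{0<..1}\<close>.\<close>

lemma connected_arc_minus_pathstart:
  assumes "arc g"
  shows "connected (path_image g - {pathstart g})"
proof -
  have inj: "inj_on g {0..1}" and cont: "continuous_on {0..1} g"
    using assms by (auto simp: arc_def path_def)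
  have "connected (g ` {0<..1})"
    by (rule connected_continuous_image[OF continuous_on_subset[OF cont]]) auto
  moreover have "{0<..1::real} = {0..1} - {0}" by auto
  then have "g ` {0<..1} = path_image g - {pathstart g}"
    using inj_on_image_set_diff[OF inj, of "{0..1}" "{0}"] by (simp add: path_image_def pathstart_def)
  ultimately show ?thesis by simp
qed

text \<open>Membership in \<open>inside J\<close> is constant on each connected component of the
  complement of \<open>J\<close>.\<close>

lemma connected_subset_inside:
  assumes "connected S" "S \<inter> J = {}" "S \<inter> inside J \<noteq> {}"
  shows "S \<subseteq> inside J"
proof
  fix y assume "y \<in> S"
  obtain x where x: "x \<in> S" "x \<in> inside J" using assms by blast
  have "connected_component (- J) x y"
    unfolding connected_component_def using assms x \<open>y \<in> S\<close> by blast
  then show "y \<in> inside J" using x inside_same_component by blast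
qed

text \<open>Following \<open>g\<close> and then \<open>h\<close> backwards gives a simple closed
  curve, to which the Jordan curve theorem applies.\<close>

lemma arc_pair_Jordan:
  fixes g h :: "real \<Rightarrow> complex"
  assumes "arc g" "arc h" "pathstart g = a" "pathfinish g = b" "pathstart h = a" "pathfinish h = b"
    and "path_image g \<inter> path_image h = {a, b}"
  shows "connected (inside (path_image g \<union> path_image h))"
    and "inside (path_image g \<union> path_image h) \<noteq> {}"
    and "frontier (inside (path_image g \<union> path_image h)) = path_image g \<union> path_image h"
proof -
  have sp: "simple_path (g +++ reversepath h)"
    using assms by (intro simple_path_join_loop) (auto simp: arc_reversepath)
  have im: "path_image (g +++ reversepath h) = path_image g \<union> path_image h"
    using assms by (simp add: path_image_join)
  note J = Jordan_inside_outside[OF sp, unfolded im]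
  show "connected (inside (path_image g \<union> path_image h))"
    "inside (path_image g \<union> path_image h) \<noteq> {}"
    "frontier (inside (path_image g \<union> path_image h)) = path_image g \<union> path_image h"
    using J assms by auto
qed

text \<open>The three arcs play symmetric roles, so facts proved for one order of them are reused by
  permuting them.\<close>

locale theta_curve =
  fixes g h k :: "real \<Rightarrow> complex" and a b :: complex
  assumes arcs: "arc g" "arc h" "arc k"
    and ends: "pathstart g = a" "pathfinish g = b" "pathstart h = a" "pathfinish h = b"
      "pathstart k = a" "pathfinish k = b"
    and meet: "path_image g \<inter> path_image h = {a, b}" "path_image g \<inter> path_image k = {a, b}"
      "path_image h \<inter> path_image k = {a, b}"
begin

lemma ends_in: "a \<in> path_image g" "b \<in> path_image g" "a \<in> path_image h" "b \<in> path_image h"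
  "a \<in> path_image k" "b \<in> path_image k"
  using meet by auto

text \<open>If the two regions met, each would be a connected set avoiding the boundary of the
  other, so they would coincide. Equal regions have equal frontiers, which would leave
  \<open>h\<close> only the points \<open>a\<close> and \<open>b\<close>.\<close>

lemma insides_disjoint:
  assumes "path_image k \<inter> inside (path_image g \<union> path_image h) = {}"
    and "path_image h \<inter> inside (path_image g \<union> path_image k) = {}"
  shows "inside (path_image g \<union> path_image h) \<inter> inside (path_image g \<union> path_image k) = {}"
proof (rule ccontr)
  let ?G = "path_image g" and ?H = "path_image h" and ?K = "path_image k"
  assume ne: "\<not> ?thesis"
  note Jh = arc_pair_Jordan[OF arcs(1,2) ends(1-4) meet(1)]
  note Jk = arc_pair_Jordan[OF arcs(1,3) ends(1,2,5,6) meet(2)]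
  have "inside (?G \<union> ?H) \<subseteq> inside (?G \<union> ?K)"
    using ne assms Jh(1) by (intro connected_subset_inside) (auto dest: inside_imp_notin)
  moreover have "inside (?G \<union> ?K) \<subseteq> inside (?G \<union> ?H)"
    using ne assms Jk(1) by (intro connected_subset_inside) (auto dest: inside_imp_notin)
  ultimately have "inside (?G \<union> ?H) = inside (?G \<union> ?K)" by (rule subset_antisym)
  then have "?G \<union> ?H = ?G \<union> ?K" using Jh(3) Jk(3) by metis
  then have "?H \<subseteq> {a, b}" using meet by blast
  then show False using arc_midpoint_not_end[OF arcs(2)] ends(3,4) by auto
qed

end

text \<open>Otherwise a point \<open>x\<close> inside \<open>?G \<union> ?H\<close> is separated
  from a far point \<open>y\<close> neither by \<open>?G \<union> ?K\<close> nor by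
  \<open>?H \<union> ?K\<close>. These two sets meet in a connected set, so by Janiszewski's theorem
  their union does not separate the points either, although \<open>?G \<union> ?H\<close>
  does.\<close>

lemma theta_curve_some_arc_inside:
  assumes "theta_curve g h k a b"
  shows "path_image g \<inter> inside (path_image h \<union> path_image k) \<noteq> {} \<or>
    path_image h \<inter> inside (path_image g \<union> path_image k) \<noteq> {} \<or>
    path_image k \<inter> inside (path_image g \<union> path_image h) \<noteq> {}"
proof (rule ccontr)
  let ?G = "path_image g" and ?H = "path_image h" and ?K = "path_image k"
  interpret theta_curve g h k a b by fact
  interpret swap: theta_curve h g k a b
    using arcs ends meet by unfold_locales auto
  assume "\<not> ?thesis"
  then have none: "?G \<inter> inside (?H \<union> ?K) = {}" "?H \<inter> inside (?G \<union> ?K) = {}"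
    "?K \<inter> inside (?G \<union> ?H) = {}" by auto
  have cpt: "compact ?G" "compact ?H" "compact ?K" using arcs by (auto simp: compact_arc_image)
  have disj: "inside (?G \<union> ?H) \<inter> inside (?G \<union> ?K) = {}" "inside (?G \<union> ?H) \<inter> inside (?H \<union> ?K) = {}"
    using insides_disjoint swap.insides_disjoint none by (simp_all add: Un_commute)
  obtain x where x: "x \<in> inside (?G \<union> ?H)"
    using arc_pair_Jordan(2)[OF arcs(1,2) ends(1-4) meet(1)] by blast
  have bdd: "bounded (?G \<union> ?H \<union> ?K)" using cpt by (simp add: compact_imp_bounded)
  then obtain y where y: "y \<in> outside (?G \<union> ?H \<union> ?K)"
    using outside_bounded_nonempty by blast
  have xn: "x \<notin> ?G \<union> ?H \<union> ?K" using x none by (auto dest: inside_imp_notin)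
  \<comment> \<open>Disjointness of the insides places \<open>x\<close> outside
    \<open>X \<union> ?K\<close>, where it shares the unbounded component with
    \<open>y\<close>.\<close>
  have cc: "connected_component (- (X \<union> ?K)) x y" if "X = ?G \<or> X = ?H" for X
  proof -
    have "x \<notin> X \<union> ?K" "x \<notin> inside (X \<union> ?K)" using that x xn disj by auto
    then have "x \<in> outside (X \<union> ?K)" using inside_Un_outside[of "X \<union> ?K"] by blast
    moreover have "y \<in> outside (X \<union> ?K)"
      using y outside_mono[of "X \<union> ?K" "?G \<union> ?H \<union> ?K"] that by auto
    moreover have "connected (outside (X \<union> ?K))"
      using that by (intro connected_outside bounded_subset[OF bdd]) auto
    ultimately show ?thesis
      unfolding connected_component_def using outside_no_overlap[of "X \<union> ?K"] by blast
  qed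
  have "(?G \<union> ?K) \<inter> (?H \<union> ?K) = ?K" using meet ends_in by auto
  then have "connected ((?G \<union> ?K) \<inter> (?H \<union> ?K))" using connected_arc_image[OF arcs(3)] by simp
  then have "connected_component (- ((?G \<union> ?K) \<union> (?H \<union> ?K))) x y"
    using cpt by (intro Janiszewski cc compact_Un compact_imp_closed) simp_all
  then have "connected_component (- (?G \<union> ?H)) x y"
    by (rule connected_component_of_subset) auto
  then have "y \<in> inside (?G \<union> ?H)" using x inside_same_component by blast
  moreover have "y \<in> outside (?G \<union> ?H)" using y outside_mono[of "?G \<union> ?H" "?G \<union> ?H \<union> ?K"] by auto
  ultimately show False using inside_Int_outside[of "?G \<union> ?H"] by blast
qed

text \<open>The inside of a closed set is open, so a frontier point in it would make it meet
  \<open>outside D\<close>, which is contained in \<open>outside J\<close>.\<close>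

lemma frontier_outside_not_inside:
  fixes J :: "complex set"
  assumes "closed J" "J \<subseteq> D" "v \<in> frontier (outside D)"
  shows "v \<notin> inside J"
proof
  assume "v \<in> inside J"
  moreover have "open (inside J)" using assms open_inside by blast
  moreover have "v \<in> closure (outside D)" using assms by (simp add: frontier_def)
  ultimately have "inside J \<inter> outside D \<noteq> {}"
    using open_Int_closure_eq_empty by blast
  then show False using outside_mono[OF assms(2)] inside_Int_outside[of J] by blast
qed

text \<open>In a theta curve some arc runs inside the cycle formed by the other two; it cannot be one of
  the two arcs through points of the outer face.\<close>

lemma theta_curve_chord_inside:
  assumes th: "theta_curve g h k a c"
    and D: "path_image g \<union> path_image h \<union> path_image k \<subseteq> D"
    and b: "b \<in> path_image g - {a, c}" "b \<in> frontier (outside D)"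
    and d: "d \<in> path_image h - {a, c}" "d \<in> frontier (outside D)"
  shows "path_image k \<inter> inside (path_image g \<union> path_image h) \<noteq> {}"
proof -
  \<comment> \<open>Stated for arbitrary arcs in order to serve both \<open>g\<close> and
    \<open>h\<close>. An arc entering the inside of the other two has all its interior points there,
    including the point on the outer face.\<close>
  have no: "path_image g' \<inter> inside (path_image h' \<union> path_image k') = {}"
    if th: "theta_curve g' h' k' a c"
      and D: "path_image g' \<union> path_image h' \<union> path_image k' \<subseteq> D"
      and b: "b' \<in> path_image g' - {a, c}" "b' \<in> frontier (outside D)" for g' h' k' b'
  proof (rule ccontr)
    let ?G = "path_image g'" and ?J = "path_image h' \<union> path_image k'"
    interpret theta_curve g' h' k' a c by fact
    assume "?G \<inter> inside ?J \<noteq> {}"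
    then have "(?G - {a, c}) \<inter> inside ?J \<noteq> {}"
      using ends_in by (auto dest: inside_imp_notin)
    moreover have "connected (?G - {a, c})"
      using connected_simple_path_endless[OF arc_imp_simple_path[OF arcs(1)]] ends by simp
    moreover have "(?G - {a, c}) \<inter> ?J = {}" using meet by auto
    ultimately have "?G - {a, c} \<subseteq> inside ?J" by (intro connected_subset_inside)
    moreover have "b' \<notin> inside ?J"
      using D b(2) arcs by (intro frontier_outside_not_inside[where D = D]) (auto simp: closed_Un closed_arc_image)
    ultimately show False using b by auto
  qed
  have "theta_curve h g k a c"
    using th by (auto simp: theta_curve_def)
  then show ?thesis
    using theta_curve_some_arc_inside[OF th] no[OF th D b] no[of h g k d] D d by blast
qed

text \<open>A subdivision of \<open>K\<^sub>4\<close>, presented as a cycle with two interleaved chords \<open>e\<close> and \<open>f\<close>: both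
  chords run inside the cycle, but \<open>e\<close> separates the ends of \<open>f\<close> there.\<close>

lemma K4_subdivision_not_outer:
  assumes th: "theta_curve g h e a c" and th': "theta_curve g' h' f b d"
    and same: "path_image g \<union> path_image h = path_image g' \<union> path_image h'"
    and ef: "path_image e \<inter> path_image f = {}"
    and gf: "path_image g \<inter> path_image f = {b}" and hf: "path_image h \<inter> path_image f = {d}"
    and ge: "path_image g' \<inter> path_image e = {c}" and he: "path_image h' \<inter> path_image e = {a}"
    and D: "path_image g \<union> path_image h \<union> path_image e \<union> path_image f \<subseteq> D"
    and outer: "{a, b, c, d} \<subseteq> frontier (outside D)"
  shows False
proof -
  let ?G = "path_image g" and ?H = "path_image h" and ?E = "path_image e" and ?F = "path_image f"
  interpret A: theta_curve g h e a c by fact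
  interpret B: theta_curve g' h' f b d by fact
  have "{a, c} \<subseteq> ?E" "{b, d} \<subseteq> ?F" using A.ends_in B.ends_in by auto
  with ef have dist: "a \<noteq> b" "a \<noteq> d" "c \<noteq> b" "c \<noteq> d" by auto
  have "a \<noteq> c" "b \<noteq> d"
    using arc_distinct_ends[OF A.arcs(1)] arc_distinct_ends[OF B.arcs(1)] A.ends B.ends by auto
  have closed: "closed ?G" "closed ?H" "closed ?E" "closed ?F"
    using A.arcs B.arcs by (auto simp: closed_arc_image)
  have bd: "b \<in> ?G" "d \<in> ?H" using gf hf by auto
  have e_in: "?E \<inter> inside (?G \<union> ?H) \<noteq> {}"
    by (rule theta_curve_chord_inside[OF th, where D = D and b = b and d = d])
      (use D outer dist bd in auto)
  \<comment> \<open>Seen from \<open>f\<close>, the cycle is cut at \<open>b\<close> and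
    \<open>d\<close>, and the outer-face points on its two halves are \<open>c\<close> and
    \<open>a\<close>.\<close>
  have "?F \<inter> inside (path_image g' \<union> path_image h') \<noteq> {}"
    by (rule theta_curve_chord_inside[OF th', where D = D and b = c and d = a])
      (use D outer dist ge he same in auto)
  then have f_in: "?F \<inter> inside (?G \<union> ?H) \<noteq> {}" by (simp add: same)
  \<comment> \<open>Since \<open>e\<close> runs inside, it cuts the inner region into two cells. It
    remains to show that \<open>f\<close> enters neither.\<close>
  obtain split: "inside (?G \<union> ?H) = inside (?G \<union> ?E) \<union> inside (?H \<union> ?E) \<union> (?E - {a, c})"
    using split_inside_simple_closed_curve[of g a c h e] A.arcs A.ends A.meet \<open>a \<noteq> c\<close> e_in
    by (metis arc_imp_simple_path)
  \<comment> \<open>Away from \<open>b\<close>, the arc \<open>f\<close> misses the boundary of this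
    cell. If it entered, it would stay there up to its end \<open>d\<close>, which lies on the outer
    face.\<close>
  have "(?F - {b}) \<inter> inside (?G \<union> ?E) = {}"
  proof (rule ccontr)
    assume "(?F - {b}) \<inter> inside (?G \<union> ?E) \<noteq> {}"
    moreover have "connected (?F - {b})"
      using connected_arc_minus_pathstart[OF B.arcs(3)] B.ends by simp
    moreover have "(?F - {b}) \<inter> (?G \<union> ?E) = {}" using ef gf by auto
    ultimately have "?F - {b} \<subseteq> inside (?G \<union> ?E)" by (intro connected_subset_inside)
    moreover have "d \<notin> inside (?G \<union> ?E)"
      using closed D outer by (intro frontier_outside_not_inside[where D = D]) auto
    ultimately show False using \<open>b \<noteq> d\<close> B.ends_in by auto
  qed
  moreover have "(?F - {d}) \<inter> inside (?H \<union> ?E) = {}"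
  proof (rule ccontr)
    assume "(?F - {d}) \<inter> inside (?H \<union> ?E) \<noteq> {}"
    moreover have "connected (?F - {d})"
      using connected_arc_minus_pathstart[OF arc_reversepath[OF B.arcs(3)]] B.ends by simp
    moreover have "(?F - {d}) \<inter> (?H \<union> ?E) = {}" using ef hf by auto
    ultimately have "?F - {d} \<subseteq> inside (?H \<union> ?E)" by (intro connected_subset_inside)
    moreover have "b \<notin> inside (?H \<union> ?E)"
      using closed D outer by (intro frontier_outside_not_inside[where D = D]) auto
    ultimately show False using \<open>b \<noteq> d\<close> B.ends_in by auto
  qed
  moreover have "b \<notin> inside (?G \<union> ?H)" "d \<notin> inside (?G \<union> ?H)"
    using bd by (auto dest: inside_imp_notin)
  ultimately show False using f_in split ef by blast
qed

subsection \<open>Outerplanar drawings of a cycle with chords\<close>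

text \<open>A cycle is written as a path whose first vertex is repeated at the end. In this form it
  can be cut at any of its vertices.\<close>

fun path_edges :: "'a list \<Rightarrow> 'a set set" where
  "path_edges (x # y # xs) = insert {x, y} (path_edges (y # xs))"
| "path_edges xs = {}"

lemma path_edges_append: "path_edges (xs @ x # ys) = path_edges (xs @ [x]) \<union> path_edges (x # ys)"
proof (induction xs)
  case (Cons z xs)
  then show ?case by (cases xs) auto
qed simp

lemma path_edges_Cons_append:
  "path_edges (z # xs @ x # ys) = path_edges (z # xs @ [x]) \<union> path_edges (x # ys)"
  using path_edges_append[of "z # xs" x ys] by simp

lemma Union_path_edges_subset: "\<Union>(path_edges xs) \<subseteq> set xs"
  by (induction xs rule: path_edges.induct) auto

lemma path_edges_conv_nth: "path_edges xs = {{xs ! i, xs ! Suc i} | i. Suc i < length xs}"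
proof (induction xs rule: path_edges.induct)
  case (1 x y xs)
  have "{{(x # y # xs) ! i, (x # y # xs) ! Suc i} | i. Suc i < length (x # y # xs)} =
    insert {x, y} {{(y # xs) ! i, (y # xs) ! Suc i} | i. Suc i < length (y # xs)}"
    (is "?L = ?R")
  proof
    show "?L \<subseteq> ?R"
    proof
      fix s assume "s \<in> ?L"
      then obtain i where "s = {(x # y # xs) ! i, (x # y # xs) ! Suc i}" "Suc i < length (x # y # xs)"
        by blast
      then show "s \<in> ?R" by (cases i) auto
    qed
    show "?R \<subseteq> ?L"
    proof
      fix s assume "s \<in> ?R"
      then consider "s = {x, y}" |
        i where "s = {(y # xs) ! i, (y # xs) ! Suc i}" "Suc i < length (y # xs)" by blast
      then show "s \<in> ?L"
      proof cases
        case 1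
        then show ?thesis by (intro CollectI exI[of _ 0]) auto
      next
        case 2
        then show ?thesis by (intro CollectI exI[of _ "Suc i"]) auto
      qed
    qed
  qed
  then show ?case using 1 by simp
qed auto

lemma path_edges_closed_subset_cycle_edges: "path_edges (x # xs @ [x]) \<subseteq> cycle_edges (x # xs)"
proof
  fix s assume "s \<in> path_edges (x # xs @ [x])"
  then obtain i where i: "s = {(x # xs @ [x]) ! i, (x # xs @ [x]) ! Suc i}" "i < length (x # xs)"
    by (auto simp: path_edges_conv_nth)
  have "(x # xs @ [x]) ! i = (x # xs) ! i"
    using i nth_append[of "x # xs" "[x]" i] by simp
  \<comment> \<open>At \<open>Suc i = length (x # xs)\<close> the repeated final \<open>x\<close>
    matches index 0, to which the modulus wraps.\<close>
  moreover have "(x # xs @ [x]) ! Suc i = (x # xs) ! (Suc i mod length (x # xs))"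
    using i by (cases "Suc i = length (x # xs)") (auto simp: nth_append)
  ultimately show "s \<in> cycle_edges (x # xs)" using i unfolding cycle_edges_def by auto
qed

lemma cycle_edges_rotate_subset: "cycle_edges (rotate m c) \<subseteq> cycle_edges c"
proof
  fix s assume "s \<in> cycle_edges (rotate m c)"
  then obtain i where i: "i < length c"
    "s = {rotate m c ! i, rotate m c ! (Suc i mod length c)}"
    by (auto simp: cycle_edges_def)
  let ?j = "(m + i) mod length c"
  have "c \<noteq> []" using i by auto
  then have "Suc i mod length c < length c" "?j < length c" by auto
  moreover have "(m + Suc i mod length c) mod length c = Suc ?j mod length c"
    by (simp add: mod_simps)
  ultimately show "s \<in> cycle_edges c"
    using i nth_rotate[of i c m] nth_rotate[of "Suc i mod length c" c m]
    unfolding cycle_edges_def by auto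
qed

section \<open>Arcs and theta curves in a plane drawing\<close>

text \<open>Lifts the pairwise condition of a plane drawing to sets of edges; disjointness of
  \<open>S\<close> and \<open>T\<close> ensures that the two edges compared are distinct.\<close>

lemma plane_drawing_disjoint_edges:
  assumes "plane_drawing H p \<gamma>" "S \<subseteq> edges H" "T \<subseteq> edges H" "S \<inter> T = {}"
  shows "(\<Union>e\<in>S. path_image (\<gamma> e)) \<inter> (\<Union>e\<in>T. path_image (\<gamma> e)) \<subseteq> p ` (\<Union>S \<inter> \<Union>T)"
proof
  fix z assume "z \<in> (\<Union>e\<in>S. path_image (\<gamma> e)) \<inter> (\<Union>e\<in>T. path_image (\<gamma> e))"
  then obtain e f where ef: "e \<in> S" "f \<in> T" "z \<in> path_image (\<gamma> e) \<inter> path_image (\<gamma> f)" by auto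
  then have "e \<in> edges H" "f \<in> edges H" "e \<noteq> f" using assms by auto
  then have "z \<in> p ` (e \<inter> f)" using assms(1) ef(3) unfolding plane_drawing_def by blast
  then show "z \<in> p ` (\<Union>S \<inter> \<Union>T)" using ef by blast
qed

text \<open>A drawing may orient an edge either way; reversing its arc if necessary makes it start
  at \<open>p x\<close>.\<close>

lemma plane_drawing_edge_arc:
  assumes "plane_drawing H p \<gamma>" "{x, y} \<in> edges H"
  obtains g where "arc g" "pathstart g = p x" "pathfinish g = p y"
    "path_image g = path_image (\<gamma> {x, y})"
proof -
  have "arc (\<gamma> {x, y})" and "{pathstart (\<gamma> {x, y}), pathfinish (\<gamma> {x, y})} = {p x, p y}"
    using assms unfolding plane_drawing_def by auto
  then consider "pathstart (\<gamma> {x, y}) = p x" "pathfinish (\<gamma> {x, y}) = p y" |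
    "pathstart (reversepath (\<gamma> {x, y})) = p x" "pathfinish (reversepath (\<gamma> {x, y})) = p y"
    by (auto simp: doubleton_eq_iff)
  then show ?thesis using that \<open>arc (\<gamma> {x, y})\<close> arc_reversepath path_image_reversepath by metis
qed

text \<open>The edge arcs are joined one after the other. The first vertex does not recur, so the
  first arc meets the rest only at their common vertex and the join is again an arc.\<close>

lemma plane_drawing_path_arc:
  assumes "plane_drawing H p \<gamma>" "distinct xs" "2 \<le> length xs" "path_edges xs \<subseteq> edges H"
  shows "\<exists>g. arc g \<and> pathstart g = p (hd xs) \<and> pathfinish g = p (last xs) \<and>
    path_image g = (\<Union>e\<in>path_edges xs. path_image (\<gamma> e)) \<and> p ` set xs \<subseteq> path_image g"
  using assms(2-4)
proof (induction xs rule: path_edges.induct)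
  case (1 x y xs)
  have "{x, y} \<in> edges H" using 1 by auto
  then obtain e where e: "arc e" "pathstart e = p x" "pathfinish e = p y"
    "path_image e = path_image (\<gamma> {x, y})"
    using plane_drawing_edge_arc[OF assms(1)] by blast
  have ends: "p x \<in> path_image e" "p y \<in> path_image e"
    using pathstart_in_path_image[of e] pathfinish_in_path_image[of e] e by auto
  show ?case
  proof (cases xs)
    case Nil
    then show ?thesis using e ends by (intro exI[of _ e]) auto
  next
    case (Cons z zs)
    then obtain g where g: "arc g" "pathstart g = p y" "pathfinish g = p (last (y # xs))"
      "path_image g = (\<Union>e\<in>path_edges (y # xs). path_image (\<gamma> e))" "p ` set (y # xs) \<subseteq> path_image g"
      using 1 by auto
    have "\<Union>(path_edges (y # xs)) \<subseteq> set (y # xs)" by (rule Union_path_edges_subset)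
    moreover have "x \<notin> set (y # xs)" using 1 by auto
    ultimately have "{x, y} \<inter> \<Union>(path_edges (y # xs)) \<subseteq> {y}" "{x, y} \<notin> path_edges (y # xs)"
      by auto
    then have "p ` ({x, y} \<inter> \<Union>(path_edges (y # xs))) \<subseteq> {p y}" by blast
    moreover have "path_image e \<inter> path_image g \<subseteq> p ` ({x, y} \<inter> \<Union>(path_edges (y # xs)))"
      using plane_drawing_disjoint_edges[OF assms(1), of "{{x, y}}" "path_edges (y # xs)"]
        \<open>{x, y} \<notin> path_edges (y # xs)\<close> 1(4) e g by simp
    ultimately have "path_image e \<inter> path_image g \<subseteq> {p y}" by (rule order_trans[rotated])
    then have "arc (e +++ g)" using e g by (intro arc_join) auto
    then show ?thesis
      using e g ends Cons by (intro exI[of _ "e +++ g"]) (auto simp: path_image_join)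
  qed
qed auto

text \<open>The ends of the chord cut the cycle into two paths. The second one is traced from
  \<open>b\<close> back to \<open>a\<close> and is reversed in the theta curve.\<close>

lemma cycle_chord_theta_curve:
  assumes pd: "plane_drawing H p \<gamma>" and dist: "distinct (a # xs @ b # ys)"
    and cyc: "path_edges (a # xs @ b # ys @ [a]) \<subseteq> edges H"
    and card2: "\<And>e. e \<in> edges H \<Longrightarrow> card e = 2"
    and chord: "{a, b} \<in> edges H" "{a, b} \<notin> path_edges (a # xs @ b # ys @ [a])"
  obtains g h k where "theta_curve g h k (p a) (p b)"
    "path_image g = (\<Union>e\<in>path_edges (a # xs @ [b]). path_image (\<gamma> e))"
    "path_image h = (\<Union>e\<in>path_edges (b # ys @ [a]). path_image (\<gamma> e))"
    "path_image k = path_image (\<gamma> {a, b})"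
    "p ` set (a # xs @ [b]) \<subseteq> path_image g"
    "p ` set (b # ys @ [a]) \<subseteq> path_image h"
proof -
  let ?S = "path_edges (a # xs @ [b])" and ?T = "path_edges (b # ys @ [a])"
  have un: "path_edges (a # xs @ b # ys @ [a]) = ?S \<union> ?T" by (rule path_edges_Cons_append)
  obtain g where g: "arc g" "pathstart g = p a" "pathfinish g = p b"
      "path_image g = (\<Union>e\<in>?S. path_image (\<gamma> e))" "p ` set (a # xs @ [b]) \<subseteq> path_image g"
    using plane_drawing_path_arc[OF pd, of "a # xs @ [b]"] dist cyc un by auto
  obtain h where h: "arc h" "pathstart h = p b" "pathfinish h = p a"
      "path_image h = (\<Union>e\<in>?T. path_image (\<gamma> e))" "p ` set (b # ys @ [a]) \<subseteq> path_image h"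
    using plane_drawing_path_arc[OF pd, of "b # ys @ [a]"] dist cyc un by auto
  obtain k where k: "arc k" "pathstart k = p a" "pathfinish k = p b"
      "path_image k = path_image (\<gamma> {a, b})"
    using plane_drawing_edge_arc[OF pd chord(1)] .
  have sub: "\<Union>?S \<subseteq> set (a # xs @ [b])" "\<Union>?T \<subseteq> set (b # ys @ [a])"
    by (rule Union_path_edges_subset)+
  then have int: "\<Union>?S \<inter> \<Union>?T \<subseteq> {a, b}" using dist by auto
  \<comment> \<open>A common edge would have both ends in \<open>{a, b}\<close> and thus be the
    chord itself, which is not an edge of the cycle.\<close>
  have "?S \<inter> ?T = {}"
  proof (rule ccontr)
    assume "?S \<inter> ?T \<noteq> {}"
    then obtain s where s: "s \<in> ?S" "s \<in> ?T" by blast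
    then have "s \<subseteq> {a, b}" "card s = 2" using int card2 cyc un by blast+
    then have "s = {a, b}" by (intro card_subset_eq) (use dist in auto)
    then show False using s chord un by auto
  qed
  have ends: "p a \<in> path_image g" "p b \<in> path_image g" "p a \<in> path_image h" "p b \<in> path_image h"
    "p a \<in> path_image k" "p b \<in> path_image k"
    using pathstart_in_path_image[of k] pathfinish_in_path_image[of k] k g h by auto
  have "path_image g \<inter> path_image h \<subseteq> {p a, p b}"
    using plane_drawing_disjoint_edges[OF pd, of ?S ?T] \<open>?S \<inter> ?T = {}\<close> int cyc un g h by auto
  moreover have "path_image g \<inter> path_image k \<subseteq> {p a, p b}"
    using plane_drawing_disjoint_edges[OF pd, of ?S "{{a, b}}"] chord cyc un g k by auto
  moreover have "path_image h \<inter> path_image k \<subseteq> {p a, p b}"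
    using plane_drawing_disjoint_edges[OF pd, of ?T "{{a, b}}"] chord cyc un h k by auto
  ultimately have "theta_curve g (reversepath h) k (p a) (p b)"
    using g h k ends by unfold_locales (auto simp: arc_reversepath)
  then show ?thesis using that g h k by auto
qed

text \<open>The four chord ends cut the cycle into paths \<open>?A\<close>, \<open>?B\<close>,
  \<open>?C\<close>, \<open>?D\<close>. Grouping them as \<open>?A \<union> ?B\<close>,
  \<open>?C \<union> ?D\<close> and as \<open>?B \<union> ?C\<close>, \<open>?D \<union> ?A\<close>
  gives two theta curves on the same cycle, one for each chord.\<close>

lemma outerplanar_no_interleaved_chords:
  assumes op: "outerplanar H" and dist: "distinct (a # ws @ b # xs @ c # ys @ d # zs)"
    and cyc: "path_edges (a # ws @ b # xs @ c # ys @ d # zs @ [a]) \<subseteq> edges H"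
    and e: "{a, c} \<in> edges H" "{a, c} \<notin> path_edges (a # ws @ b # xs @ c # ys @ d # zs @ [a])"
    and f: "{b, d} \<in> edges H" "{b, d} \<notin> path_edges (a # ws @ b # xs @ c # ys @ d # zs @ [a])"
  shows False
proof -
  obtain p \<gamma> where pd: "plane_drawing H p \<gamma>"
    and fr: "\<And>v. v \<in> verts H \<Longrightarrow> p v \<in> frontier (outside (drawing_image H p \<gamma>))"
    using op unfolding outerplanar_def by blast
  have card2: "card s = 2" and inV: "s \<subseteq> verts H" if "s \<in> edges H" for s
    using op that unfolding outerplanar_def simple_graph_def by auto
  let ?P = "path_edges (a # ws @ b # xs @ c # ys @ d # zs @ [a])"
  let ?im = "\<lambda>S. \<Union>e\<in>S. path_image (\<gamma> e)"
  let ?A = "path_edges (a # ws @ [b])" and ?B = "path_edges (b # xs @ [c])"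
    and ?C = "path_edges (c # ys @ [d])" and ?D = "path_edges (d # zs @ [a])"
  have P: "?P = ?A \<union> ?B \<union> ?C \<union> ?D"
    by (simp only: path_edges_Cons_append[of a ws b "xs @ c # ys @ d # zs @ [a]"]
      path_edges_Cons_append[of b xs c "ys @ d # zs @ [a]"]
      path_edges_Cons_append[of c ys d "zs @ [a]"] Un_assoc)
  have P1: "path_edges (a # (ws @ b # xs) @ [c]) = ?A \<union> ?B"
    using path_edges_Cons_append[of a ws b "xs @ [c]"] by (simp only: append_Cons append_assoc)
  have P2: "path_edges (c # (ys @ d # zs) @ [a]) = ?C \<union> ?D"
    using path_edges_Cons_append[of c ys d "zs @ [a]"] by (simp only: append_Cons append_assoc)
  have P3: "path_edges (b # (xs @ c # ys) @ [d]) = ?B \<union> ?C"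
    using path_edges_Cons_append[of b xs c "ys @ [d]"] by (simp only: append_Cons append_assoc)
  have P4: "path_edges (d # (zs @ a # ws) @ [b]) = ?D \<union> ?A"
    using path_edges_Cons_append[of d zs a "ws @ [b]"] by (simp only: append_Cons append_assoc)
  \<comment> \<open>The same cycle read from \<open>b\<close>, as the theta curve of the chord
    \<open>{b, d}\<close> requires.\<close>
  have P': "path_edges (b # (xs @ c # ys) @ d # (zs @ a # ws) @ [b]) = ?P"
    by (simp only: path_edges_Cons_append[of b "xs @ c # ys" d "(zs @ a # ws) @ [b]"] P P3 P4 Un_ac)
  obtain g h k where th: "theta_curve g h k (p a) (p c)"
    "path_image g = ?im (?A \<union> ?B)" "path_image h = ?im (?C \<union> ?D)"
    "path_image k = path_image (\<gamma> {a, c})"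
    "p ` set (a # (ws @ b # xs) @ [c]) \<subseteq> path_image g"
    "p ` set (c # (ys @ d # zs) @ [a]) \<subseteq> path_image h"
  proof -
    have "distinct (a # (ws @ b # xs) @ c # (ys @ d # zs))" using dist by auto
    moreover have "path_edges (a # (ws @ b # xs) @ c # (ys @ d # zs) @ [a]) \<subseteq> edges H"
      "{a, c} \<notin> path_edges (a # (ws @ b # xs) @ c # (ys @ d # zs) @ [a])"
      using cyc e by auto
    ultimately show ?thesis
      using cycle_chord_theta_curve[OF pd _ _ card2 e(1), of "ws @ b # xs" "ys @ d # zs"] P1 P2 that
      by metis
  qed
  obtain g' h' k' where th': "theta_curve g' h' k' (p b) (p d)"
    "path_image g' = ?im (?B \<union> ?C)" "path_image h' = ?im (?D \<union> ?A)"
    "path_image k' = path_image (\<gamma> {b, d})"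
    "p ` set (b # (xs @ c # ys) @ [d]) \<subseteq> path_image g'"
    "p ` set (d # (zs @ a # ws) @ [b]) \<subseteq> path_image h'"
  proof -
    have "distinct (b # (xs @ c # ys) @ d # (zs @ a # ws))" using dist by auto
    moreover have "path_edges (b # (xs @ c # ys) @ d # (zs @ a # ws) @ [b]) \<subseteq> edges H"
      "{b, d} \<notin> path_edges (b # (xs @ c # ys) @ d # (zs @ a # ws) @ [b])"
      using P' cyc f by auto
    ultimately show ?thesis
      using cycle_chord_theta_curve[OF pd _ _ card2 f(1), of "xs @ c # ys" "zs @ a # ws"] P3 P4 that
      by metis
  qed
  note sub = Union_path_edges_subset[of "a # (ws @ b # xs) @ [c]", unfolded P1]
    Union_path_edges_subset[of "c # (ys @ d # zs) @ [a]", unfolded P2]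
    Union_path_edges_subset[of "b # (xs @ c # ys) @ [d]", unfolded P3]
    Union_path_edges_subset[of "d # (zs @ a # ws) @ [b]", unfolded P4]
  have sub_edges: "?A \<union> ?B \<subseteq> edges H" "?C \<union> ?D \<subseteq> edges H" "?B \<union> ?C \<subseteq> edges H" "?D \<union> ?A \<subseteq> edges H"
    using cyc unfolding P by blast+
  \<comment> \<open>One half of the cycle, with vertices in \<open>L\<close>, against the chord of
    the other theta curve: only the chord end \<open>u\<close> can lie on this half.\<close>
  have meet: "?im S \<inter> path_image (\<gamma> {u, v}) \<subseteq> {p u}"
    if "S \<subseteq> edges H" "\<Union>S \<subseteq> set L" "{u, v} \<in> edges H" "v \<notin> set L" for S L u v
  proof -
    have "{u, v} \<notin> S" "p ` (\<Union>S \<inter> {u, v}) \<subseteq> {p u}" using that by blast+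
    then show ?thesis
      using plane_drawing_disjoint_edges[OF pd, of S "{{u, v}}"] that(1,3) by simp
  qed
  have "{a, c} \<inter> {b, d} = {}" "{b, d} \<noteq> {a, c}" using dist by auto
  then have "path_image k \<inter> path_image k' = {}"
    using plane_drawing_disjoint_edges[OF pd, of "{{a, c}}" "{{b, d}}"] e(1) f(1)
    unfolding th(4) th'(4) by simp
  moreover have "path_image g \<inter> path_image k' \<subseteq> {p b}"
    unfolding th(2) th'(4) by (rule meet[OF sub_edges(1) sub(1)]) (use f(1) dist in auto)
  moreover have "path_image h \<inter> path_image k' \<subseteq> {p d}"
    unfolding th(3) th'(4) insert_commute[of b d]
    by (rule meet[OF sub_edges(2) sub(2)]) (use f(1) dist in \<open>auto simp: insert_commute\<close>)
  moreover have "path_image g' \<inter> path_image k \<subseteq> {p c}"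
    unfolding th'(2) th(4) insert_commute[of a c]
    by (rule meet[OF sub_edges(3) sub(3)]) (use e(1) dist in \<open>auto simp: insert_commute\<close>)
  moreover have "path_image h' \<inter> path_image k \<subseteq> {p a}"
    unfolding th'(3) th(4) by (rule meet[OF sub_edges(4) sub(4)]) (use e(1) dist in auto)
  moreover have "path_image g \<union> path_image h = path_image g' \<union> path_image h'"
    unfolding th(2,3) th'(2,3) by blast
  moreover have "path_image g \<union> path_image h \<union> path_image k \<union> path_image k' \<subseteq> drawing_image H p \<gamma>"
    unfolding th(2-4) th'(4) drawing_image_def using sub_edges(1,2) e(1) f(1) by blast
  moreover have "{p a, p b, p c, p d} \<subseteq> frontier (outside (drawing_image H p \<gamma>))"
    using fr inV[OF e(1)] inV[OF f(1)] by blast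
  moreover have "p a \<in> path_image k" "p c \<in> path_image k" "p b \<in> path_image k'" "p d \<in> path_image k'"
    using theta_curve.ends_in[OF th(1)] theta_curve.ends_in[OF th'(1)] by auto
  moreover have "p b \<in> path_image g" "p d \<in> path_image h" "p c \<in> path_image g'" "p a \<in> path_image h'"
    using th(5,6) th'(5,6) by auto
  ultimately show False
    using K4_subdivision_not_outer[OF th(1) th'(1), of "drawing_image H p \<gamma>"] by blast
qed

subsection \<open>Regular polygons\<close>

text \<open>These are the \<open>n\<close>-th roots of unity. The index may be any natural number,
  so that rotations are plain additions to it.\<close>

definition polygon_vertex :: "nat \<Rightarrow> nat \<Rightarrow> complex" where
  "polygon_vertex n k = cis (2 * pi * real k / real n)"

lemma polygon_vertex_add_period: "n > 0 \<Longrightarrow> polygon_vertex n (k + n) = polygon_vertex n k"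
proof -
  assume "n > 0"
  then have "2 * pi * real (k + n) / real n = 2 * pi * real k / real n + 2 * pi"
    by (simp add: field_simps)
  then show ?thesis unfolding polygon_vertex_def by (simp add: cis.ctr)
qed

lemma polygon_vertex_cong:
  assumes "k mod n = l mod n" "n > 0"
  shows "polygon_vertex n k = polygon_vertex n l"
proof -
  have "polygon_vertex n (j + m * n) = polygon_vertex n j" for j m
  proof (induction m)
    case (Suc m)
    have "j + Suc m * n = (j + m * n) + n" by simp
    then show ?case using Suc polygon_vertex_add_period[OF assms(2)] by metis
  qed simp
  then have "polygon_vertex n j = polygon_vertex n (j mod n)" for j
    by (metis mod_div_mult_eq)
  then show ?thesis using assms by metis
qed

lemma inj_on_polygon_vertex: "inj_on (polygon_vertex n) {..<n}"
  using Complex.bij_betw_roots_unity[of n] unfolding bij_betw_def polygon_vertex_def by (cases "n = 0") auto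

lemma norm_polygon_vertex [simp]: "norm (polygon_vertex n k) = 1"
  by (simp add: polygon_vertex_def)

lemma polygon_vertex_in_polygon: "n > 0 \<Longrightarrow> polygon_vertex n k \<in> polygon_vertex n ` {..<n}"
  using polygon_vertex_cong[of k n "k mod n"]
  by (metis imageI lessThan_iff mod_less_divisor mod_mod_trivial)

section \<open>Convex position on the unit circle\<close>

text \<open>Strict Cauchy-Schwarz for unit vectors: the tangent at \<open>x\<close> has every other
  point of the circle strictly on one side. The next two lemmas use the resulting open half-plane,
  which is convex and misses \<open>x\<close>.\<close>

lemma inner_unit_less_1:
  fixes x y :: complex
  assumes "norm x = 1" "norm y = 1" "x \<noteq> y"
  shows "x \<bullet> y < 1"
proof -
  have "0 < (norm (x - y))\<^sup>2" using assms by simp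
  then have "0 < x \<bullet> x + y \<bullet> y - 2 * (x \<bullet> y)"
    by (simp add: power2_norm_eq_inner inner_diff_left inner_diff_right inner_commute)
  then show ?thesis using assms by (simp add: dot_square_norm)
qed

lemma convex_position_unit_circle:
  assumes "\<And>x. x \<in> P \<Longrightarrow> norm x = 1"
  shows "convex_position P"
  unfolding convex_position_def
proof
  fix x assume x: "x \<in> P"
  have "convex hull (P - {x}) \<subseteq> {y. x \<bullet> y < 1}"
    by (rule hull_minimal) (use x assms inner_unit_less_1 convex_halfspace_lt in auto)
  moreover have "x \<bullet> x = 1" using x assms by (simp add: dot_square_norm)
  ultimately show "x \<notin> convex hull (P - {x})" by auto
qed

lemma unit_circle_notin_open_segment:
  fixes u v w :: complex
  assumes "norm u = 1" "norm v = 1" "norm w = 1"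
  shows "w \<notin> open_segment u v"
proof
  assume w: "w \<in> open_segment u v"
  then have "w \<noteq> u" "w \<noteq> v" by (auto simp: open_segment_def)
  then have "{u, v} \<subseteq> {y. w \<bullet> y < 1}" using assms inner_unit_less_1 by auto
  then have "convex hull {u, v} \<subseteq> {y. w \<bullet> y < 1}" by (rule hull_minimal) (rule convex_halfspace_lt)
  then have "w \<bullet> w < 1" using w by (auto simp: open_segment_def segment_convex_hull)
  then show False using assms by (simp add: dot_square_norm)
qed

section \<open>Sides of a polygon chord\<close>

lemma inner_open_segment:
  fixes m u v z :: complex
  assumes "z \<in> open_segment u v"
  obtains t where "0 < t" "t < 1" "m \<bullet> z - h = (1 - t) * (m \<bullet> u - h) + t * (m \<bullet> v - h)"
proof -
  obtain t where t: "0 < t" "t < 1" "z = (1 - t) *\<^sub>R u + t *\<^sub>R v"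
    using assms by (auto simp: in_segment)
  have "m \<bullet> z - h = (1 - t) * (m \<bullet> u - h) + t * (m \<bullet> v - h)"
    by (simp add: t inner_add_right algebra_simps)
  then show ?thesis using that t by blast
qed

lemma inner_cis: "cis x \<bullet> cis y = cos (x - y)"
  by (simp add: inner_complex_def cos_diff)

text \<open>The first factor is positive for \<open>k > a\<close> and the second one for \<open>k < b\<close>, so the left-hand side
  tells on which side of the chord from \<open>a\<close> to \<open>b\<close> the vertex \<open>k\<close> lies.\<close>

lemma polygon_chord_functional:
  assumes "n > 0"
  shows "cis (pi * real (a + b + 2 * t) / real n) \<bullet> polygon_vertex n (k + t)
      - cos (pi * (real b - real a) / real n) =
    2 * sin (pi * (real k - real a) / real n) * sin (pi * (real b - real k) / real n)"
proof -
  let ?x = "pi * (real a + real b - 2 * real k) / real n" and ?y = "pi * (real b - real a) / real n"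
  \<comment> \<open>The rotation by \<open>t\<close> cancels here; the sum-to-product formula for
    cosines then yields the two sines.\<close>
  have "pi * real (a + b + 2 * t) / real n - 2 * pi * real (k + t) / real n = ?x"
    using assms by (simp add: field_simps)
  then have "cis (pi * real (a + b + 2 * t) / real n) \<bullet> polygon_vertex n (k + t) = cos ?x"
    unfolding polygon_vertex_def inner_cis by simp
  moreover have half: "(?x + ?y) / 2 = pi * (real b - real k) / real n"
    "(?y - ?x) / 2 = pi * (real k - real a) / real n"
    unfolding add_divide_distrib[symmetric] diff_divide_distrib[symmetric]
    using assms by (simp_all add: field_simps)
  moreover have "cos ?x - cos ?y = 2 * sin (pi * (real b - real k) / real n) * sin (pi * (real k - real a) / real n)"
    using cos_diff_cos[of ?x ?y] unfolding half .
  ultimately show ?thesis by (simp only: mult_ac)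
qed

lemma sin_pi_frac_pos:
  assumes "i < j" "j < n"
  shows "sin (pi * (real j - real i) / real n) > 0"
proof (rule sin_gt_zero)
  show "0 < pi * (real j - real i) / real n" using assms by simp
  have "real j - real i < real n" using assms by linarith
  then show "pi * (real j - real i) / real n < pi" using assms by (simp add: divide_less_eq)
qed

lemma sin_pi_frac_neg:
  assumes "i < j" "j < n"
  shows "sin (pi * (real i - real j) / real n) < 0"
proof -
  have "pi * (real i - real j) / real n = - (pi * (real j - real i) / real n)"
    by (metis minus_diff_eq minus_divide_left mult_minus_right)
  then show ?thesis using sin_pi_frac_pos[OF assms] by (simp only: sin_minus)
qed

text \<open>On the line of the first chord the affine functional vanishes. On the open second chord
  it is a proper convex combination of two values of the same weak sign that are not both
  zero.\<close>

lemma polygon_chords_disjoint_aux: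
  assumes ab: "a < b" "b < n" and cd: "c \<noteq> d" "c < n" "d < n" "{a, b} \<noteq> {c, d}"
    and side: "(a \<le> c \<and> c \<le> b \<and> a \<le> d \<and> d \<le> b) \<or> ((c \<le> a \<or> b \<le> c) \<and> (d \<le> a \<or> b \<le> d))"
  shows "open_segment (polygon_vertex n (a + t)) (polygon_vertex n (b + t)) \<inter>
    open_segment (polygon_vertex n (c + t)) (polygon_vertex n (d + t)) = {}"
proof (rule ccontr)
  assume "\<not> ?thesis"
  then obtain z where z: "z \<in> open_segment (polygon_vertex n (a + t)) (polygon_vertex n (b + t))"
    "z \<in> open_segment (polygon_vertex n (c + t)) (polygon_vertex n (d + t))" by blast
  \<comment> \<open>\<open>m\<close> is the unit normal of the first chord and \<open>h\<close> the
    signed distance of its line from the center, so \<open>F k\<close> is the signed distance of the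
    vertex \<open>k + t\<close> from that line.\<close>
  define m where "m = cis (pi * real (a + b + 2 * t) / real n)"
  define h where "h = cos (pi * (real b - real a) / real n)"
  define F where "F k = 2 * sin (pi * (real k - real a) / real n) * sin (pi * (real b - real k) / real n)" for k
  have "n > 0" using ab by simp
  then have F: "m \<bullet> polygon_vertex n (k + t) - h = F k" for k
    unfolding m_def h_def F_def by (rule polygon_chord_functional)
  have F0: "F a = 0" "F b = 0" by (simp_all add: F_def)
  have pos: "F k > 0" if "a < k" "k < b" for k
    using sin_pi_frac_pos[of a k n] sin_pi_frac_pos[of k b n] that ab by (simp add: F_def)
  have neg: "F k < 0" if "k < a \<or> b < k" "k < n" for k
    using that(1)
  proof
    assume "k < a"
    then show ?thesis
      using sin_pi_frac_neg[of k a n] sin_pi_frac_pos[of k b n] ab by (simp add: F_def mult_neg_pos)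
  next
    assume "b < k"
    then show ?thesis
      using sin_pi_frac_pos[of a k n] sin_pi_frac_neg[of b k n] ab that by (simp add: F_def mult_pos_neg)
  qed
  obtain s where "m \<bullet> z - h = (1 - s) * F a + s * F b"
    using inner_open_segment[OF z(1), of m h] unfolding F by metis
  then have z0: "m \<bullet> z - h = 0" using F0 by simp
  obtain r where r: "0 < r" "r < 1" "m \<bullet> z - h = (1 - r) * F c + r * F d"
    using inner_open_segment[OF z(2), of m h] unfolding F by metis
  have off: "\<not> (c \<in> {a, b} \<and> d \<in> {a, b})" using cd by auto
  show False
    using side
  proof
    assume "a \<le> c \<and> c \<le> b \<and> a \<le> d \<and> d \<le> b"
    then have "(F c > 0 \<and> F d \<ge> 0) \<or> (F c \<ge> 0 \<and> F d > 0)"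
      using pos F0 off by (metis insert_iff less_le order.order_iff_strict)
    then have "(1 - r) * F c + r * F d > 0"
      using r(1,2) by (auto intro: add_pos_nonneg add_nonneg_pos)
    then show False using r z0 by simp
  next
    assume "(c \<le> a \<or> b \<le> c) \<and> (d \<le> a \<or> b \<le> d)"
    then have "(F c < 0 \<and> F d \<le> 0) \<or> (F c \<le> 0 \<and> F d < 0)"
      using neg F0 off cd by (metis insert_iff less_le order.order_iff_strict)
    then have "(1 - r) * F c + r * F d < 0"
    proof (elim disjE conjE)
      assume "F c < 0" "F d \<le> 0"
      then show ?thesis using r(1,2) by (intro add_neg_nonpos mult_pos_neg mult_nonneg_nonpos) auto
    next
      assume "F c \<le> 0" "F d < 0"
      then show ?thesis using r(1,2) by (intro add_nonpos_neg mult_pos_neg mult_nonneg_nonpos) auto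
    qed
    then show False using r z0 by simp
  qed
qed

text \<open>Alternation around the cycle shows up as alternation in the linear order of the indices,
  wherever the cycle is cut open.\<close>

definition interleaved :: "nat set \<Rightarrow> nat set \<Rightarrow> bool" where
  "interleaved s t \<longleftrightarrow> (\<exists>i j k l. i < j \<and> j < k \<and> k < l \<and>
     (s = {i, k} \<and> t = {j, l} \<or> s = {j, l} \<and> t = {i, k}))"

lemma polygon_chords_disjoint:
  assumes "a \<noteq> b" "a < n" "b < n" "c \<noteq> d" "c < n" "d < n" "{a, b} \<noteq> {c, d}"
    and "\<not> interleaved {a, b} {c, d}"
  shows "\<not> segments_cross (polygon_vertex n (a + t)) (polygon_vertex n (b + t))
    (polygon_vertex n (c + t)) (polygon_vertex n (d + t))"
proof -
  have *: "\<not> segments_cross (polygon_vertex n (a + t)) (polygon_vertex n (b + t))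
      (polygon_vertex n (c + t)) (polygon_vertex n (d + t))"
    if "a < b" "b < n" "c < d" "d < n" "{a, b} \<noteq> {c, d}" "\<not> interleaved {a, b} {c, d}" for a b c d
  proof -
    \<comment> \<open>With both pairs sorted, these are the only two interleaving patterns; without
      them the second chord lies weakly on one side of the first.\<close>
    have "\<not> (a < c \<and> c < b \<and> b < d)" "\<not> (c < a \<and> a < d \<and> d < b)"
      using that(6) unfolding interleaved_def by blast+
    then have "(a \<le> c \<and> c \<le> b \<and> a \<le> d \<and> d \<le> b) \<or> ((c \<le> a \<or> b \<le> c) \<and> (d \<le> a \<or> b \<le> d))"
      using that by linarith
    then show ?thesis
      unfolding segments_cross_def using polygon_chords_disjoint_aux[of a b n c d t] that by auto
  qed
  consider "a < b" "c < d" | "a < b" "d < c" | "b < a" "c < d" | "b < a" "d < c"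
    using assms by linarith
  then show ?thesis
  proof cases
    case 1
    then show ?thesis using * assms by blast
  next
    case 2
    then show ?thesis using *[of a b d c] assms
      by (simp add: insert_commute segments_cross_def open_segment_commute)
  next
    case 3
    then show ?thesis using *[of b a c d] assms
      by (simp add: insert_commute segments_cross_def open_segment_commute)
  next
    case 4
    then show ?thesis using *[of b a d c] assms
      by (simp add: insert_commute segments_cross_def open_segment_commute)
  qed
qed

text \<open>Consecutive indices have nothing between them, and the closing edge joins the least and
  the greatest index, beyond which there is nothing.\<close>

lemma cycle_edge_not_interleaved:
  assumes "i < n" "u \<subseteq> {..<n}"
  shows "\<not> interleaved {i, Suc i mod n} u" "\<not> interleaved u {i, Suc i mod n}"
proof -
  have "\<not> interleaved {i, Suc i mod n} u \<and> \<not> interleaved u {i, Suc i mod n}"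
  proof (cases "Suc i = n")
    case True
    have "\<forall>x\<in>u. x \<le> i" using assms True by auto
    then show ?thesis unfolding interleaved_def using True by (auto simp: doubleton_eq_iff)
  next
    case False
    then have "Suc i mod n = Suc i" using assms by simp
    then show ?thesis unfolding interleaved_def by (auto simp: doubleton_eq_iff)
  qed
  then show "\<not> interleaved {i, Suc i mod n} u" "\<not> interleaved u {i, Suc i mod n}" by auto
qed

subsection \<open>The universal graph\<close>

text \<open>Every residue modulo \<open>n\<close> is the difference of two elements of this set: writing it as
  \<open>q * s + r\<close> with \<open>s = floor_sqrt n\<close>, it is \<open>r - (n - q * s)\<close>.\<close>

definition hub :: "nat \<Rightarrow> nat set" where
  "hub n = {..<floor_sqrt n} \<union> (\<lambda>q. n - q * floor_sqrt n) ` {..n div floor_sqrt n}"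

text \<open>A single shift \<open>t\<close> brings two given indices into the hub at once. The claim
  is up to congruence, as \<open>hub n\<close> contains \<open>n\<close> itself, from
  \<open>q = 0\<close>.\<close>

lemma hub_difference:
  assumes "i < n" "j < n"
  obtains t x y where "x \<in> hub n" "y \<in> hub n" "(i + t) mod n = x mod n" "(j + t) mod n = y mod n"
proof -
  define s where "s = floor_sqrt n"
  define e where "e = (j + (n - i)) mod n"
  define q where "q = e div s"
  have s: "s > 0" using assms by (simp add: s_def)
  have "e < n" using assms by (simp add: e_def)
  have e: "q * s + e mod s = e" by (simp add: q_def)
  then have qs: "q * s \<le> n" using \<open>e < n\<close> by linarith
  have "q \<le> n div s" using \<open>e < n\<close> by (simp add: q_def div_le_mono)
  \<comment> \<open>With \<open>e\<close> the residue of \<open>j - i\<close>, the shift is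
    \<open>(n - q * s) + (n - i)\<close>: it sends \<open>i\<close> to \<open>n - q * s\<close> and
    \<open>j\<close> to \<open>e mod s\<close>, modulo \<open>n\<close>.\<close>
  show ?thesis
  proof
    show "n - q * s \<in> hub n" unfolding hub_def using \<open>q \<le> n div s\<close> by (auto simp: s_def)
    show "e mod s \<in> hub n" unfolding hub_def using s by (auto simp: s_def)
    have "i + ((n - q * s) + (n - i)) = (n - q * s) + n" using assms by simp
    then show "(i + ((n - q * s) + (n - i))) mod n = (n - q * s) mod n" by simp
    have "((j + (n - i)) + (n - q * s)) mod n = (e + (n - q * s)) mod n"
      by (simp add: e_def mod_add_left_eq)
    moreover have "e + (n - q * s) = e mod s + n" using e qs by linarith
    ultimately show "(j + ((n - q * s) + (n - i))) mod n = (e mod s) mod n"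
      by (simp add: add_ac)
  qed
qed

lemma card_hub: "card (hub n) \<le> 2 * floor_sqrt n + 3"
proof -
  define s where "s = floor_sqrt n"
  have "n < (Suc s)\<^sup>2" by (simp add: s_def Suc_floor_sqrt_power2_gt)
  \<comment> \<open>This bounds the quotient by \<open>s + 2\<close>; for \<open>s = 0\<close> the
    quotient is 0 by convention. The final constant 3 also counts the term
    \<open>q = 0\<close>.\<close>
  then have "n \<le> (s + 2) * s" by (simp add: power2_eq_square)
  then have "n div s \<le> s + 2"
    by (metis div_le_mono div_mult_self_is_m gr0I nat_le_linear div_by_0 le0)
  have "card (hub n) \<le> card {..<s} + card ((\<lambda>q. n - q * s) ` {..n div s})"
    unfolding hub_def s_def by (rule card_Un_le)
  also have "\<dots> \<le> s + Suc (n div s)"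
    using card_image_le[of "{..n div s}" "\<lambda>q. n - q * s"] by simp
  finally show ?thesis using \<open>n div s \<le> s + 2\<close> by (simp add: s_def)
qed

lemma finite_hub: "finite (hub n)"
  by (simp add: hub_def)

text \<open>The pairs with \<open>l = Suc k\<close> form the boundary of the polygon. Indices are
  unbounded and may be congruent modulo \<open>n\<close>; demanding distinct points excludes
  loops.\<close>

definition hub_graph :: "nat \<Rightarrow> complex ugraph" where
  "hub_graph n = \<lparr>verts = polygon_vertex n ` {..<n},
     edges = {{polygon_vertex n k, polygon_vertex n l} | k l.
       (k \<in> hub n \<or> l = Suc k) \<and> polygon_vertex n k \<noteq> polygon_vertex n l}\<rparr>"

lemma polygon_vertex_0 [simp]: "polygon_vertex 0 k = 1"
  by (simp add: polygon_vertex_def)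

lemma hub_graph_geometric: "convex_geometric_graph (hub_graph n)"
proof -
  have verts: "norm x = 1" if "x \<in> verts (hub_graph n)" for x
    using that by (auto simp: hub_graph_def)
  have edge: "e \<subseteq> verts (hub_graph n) \<and> card e = 2" if e: "e \<in> edges (hub_graph n)" for e
  proof -
    obtain k l where kl: "e = {polygon_vertex n k, polygon_vertex n l}"
      "polygon_vertex n k \<noteq> polygon_vertex n l"
      using e unfolding hub_graph_def by simp blast
    then have "n > 0" by (intro gr0I) auto
    then show ?thesis using kl polygon_vertex_in_polygon[of n] by (auto simp: hub_graph_def)
  qed
  then have "w \<notin> open_segment u v" if "{u, v} \<in> edges (hub_graph n)" "w \<in> verts (hub_graph n)" for u v w
    using that verts by (intro unit_circle_notin_open_segment) blast+
  moreover have "simple_graph (hub_graph n)"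
    unfolding simple_graph_def using edge by (auto simp: hub_graph_def)
  moreover have "convex_position (verts (hub_graph n))"
    by (rule convex_position_unit_circle) (rule verts)
  ultimately show ?thesis
    unfolding convex_geometric_graph_def geometric_graph_def by blast
qed

section \<open>Numbers of vertices and edges\<close>

lemma card_verts_hub_graph: "card (verts (hub_graph n)) = n"
  using card_image[OF inj_on_polygon_vertex[of n]] by (simp add: hub_graph_def)

lemma card_edges_hub_graph: "card (edges (hub_graph n)) \<le> (2 * floor_sqrt n + 4) * n"
proof -
  let ?P = "polygon_vertex n"
  let ?A = "(\<lambda>(k, l). {?P k, ?P l}) ` (hub n \<times> {..<n})" and ?B = "(\<lambda>k. {?P k, ?P (Suc k)}) ` {..<n}"
  have "edges (hub_graph n) \<subseteq> ?A \<union> ?B"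
  proof
    fix e assume "e \<in> edges (hub_graph n)"
    then obtain k l where kl: "e = {?P k, ?P l}" "k \<in> hub n \<or> l = Suc k" "?P k \<noteq> ?P l"
      by (auto simp: hub_graph_def)
    then have n: "n > 0" by (intro gr0I) auto
    \<comment> \<open>Reducing indices modulo \<open>n\<close> leaves at most \<open>n\<close>
      partners for each hub index and at most \<open>n\<close> boundary edges.\<close>
    have "?P l = ?P (l mod n)" "?P k = ?P (k mod n)" "?P (Suc k) = ?P (Suc (k mod n))"
      using n by (auto intro!: polygon_vertex_cong simp: mod_simps)
    then have "e \<in> ?A" if "k \<in> hub n"
      using kl that n by (intro image_eqI[of _ _ "(k, l mod n)"]) auto
    moreover have "e \<in> ?B" if "l = Suc k"
      using kl that n \<open>?P k = ?P (k mod n)\<close> \<open>?P (Suc k) = ?P (Suc (k mod n))\<close>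
      by (intro image_eqI[of _ _ "k mod n"]) auto
    ultimately show "e \<in> ?A \<union> ?B" using kl by blast
  qed
  then have "card (edges (hub_graph n)) \<le> card (?A \<union> ?B)"
    using finite_hub by (intro card_mono) auto
  also have "\<dots> \<le> card ?A + card ?B" by (rule card_Un_le)
  also have "\<dots> \<le> card (hub n) * n + n"
    using card_image_le[of "hub n \<times> {..<n}" "\<lambda>(k, l). {?P k, ?P l}"]
      card_image_le[of "{..<n}" "\<lambda>k. {?P k, ?P (Suc k)}"] finite_hub
    by (intro add_mono) (auto simp: card_cartesian_product)
  also have "\<dots> \<le> (2 * floor_sqrt n + 3) * n + n"
    using card_hub by (simp add: mult_le_mono1)
  finally show ?thesis by (simp add: algebra_simps)
qed

lemma card_edges_hub_graph_bigo: "(\<lambda>n. real (card (edges (hub_graph n)))) \<in> O(\<lambda>n. real n powr (3 / 2))"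
proof (rule bigoI)
  show "\<forall>\<^sub>F n in sequentially. norm (real (card (edges (hub_graph n)))) \<le> 6 * norm (real n powr (3 / 2))"
  proof (intro always_eventually allI)
    fix n :: nat
    show "norm (real (card (edges (hub_graph n)))) \<le> 6 * norm (real n powr (3 / 2))"
    proof (cases "n = 0")
      case True
      then show ?thesis using card_edges_hub_graph[of 0] by simp
    next
      case False
      have "real (floor_sqrt n) \<le> sqrt (real n)"
        by (rule real_le_rsqrt) (metis floor_sqrt_power2_le of_nat_le_iff of_nat_power)
      moreover have "1 \<le> sqrt (real n)" using False by simp
      \<comment> \<open>The constant 6 absorbs the summand 4, using
        \<open>1 \<le> sqrt (real n)\<close>.\<close>
      ultimately have "2 * real (floor_sqrt n) + 4 \<le> 6 * sqrt (real n)" by linarith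
      then have "(2 * real (floor_sqrt n) + 4) * real n \<le> 6 * sqrt (real n) * real n"
        by (rule mult_right_mono) simp
      moreover have "real (card (edges (hub_graph n))) \<le> (2 * real (floor_sqrt n) + 4) * real n"
        using of_nat_mono[OF card_edges_hub_graph[of n], where 'a = real] by simp
      moreover have "sqrt (real n) * real n = real n powr (3 / 2)"
        using False powr_add[of "real n" "1 / 2" 1] by (simp add: powr_half_sqrt)
      ultimately show ?thesis by simp
    qed
  qed
qed

section \<open>Embedding a cycle with two chords\<close>

lemma add_mod_cancel_right_less:
  fixes l m t n :: nat
  assumes "(l + t) mod n = (m + t) mod n" "l < n" "m < n"
  shows "l = m"
proof -
  have "l = m" if "(l + t) mod n = (m + t) mod n" "m < n" "l \<le> m" "l < n" for l m
  proof -
    have "n dvd (m + t) - (l + t)" using that mod_eq_dvd_iff_nat[of "l + t" "m + t" n] by simp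
    then have "n dvd m - l" by simp
    then show ?thesis using that by (metis diff_is_0_eq dvd_imp_le le_antisym less_imp_diff_less not_less gr0I)
  qed
  then show ?thesis using assms by (metis nat_le_linear)
qed

lemma chord_nth:
  assumes "simple_graph H" "distinct c" "set c = verts H" "e \<in> edges H"
  obtains i j where "i < length c" "j < length c" "i \<noteq> j" "e = {c ! i, c ! j}"
proof -
  have "card e = 2" "e \<subseteq> set c" using assms unfolding simple_graph_def by auto
  then obtain u v where "e = {u, v}" "u \<noteq> v" "u \<in> set c" "v \<in> set c"
    by (auto simp: card_2_iff)
  then show ?thesis using that by (metis in_set_conv_nth)
qed

text \<open>The cycle is laid around the polygon, rotated so that the chord ends \<open>i\<close>
  and \<open>j\<close> land on hub points. Since a hub point is joined to every other vertex, both
  chords are present. Crossings depend only on how the index pairs interleave, not on the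
  rotation.\<close>

lemma hub_graph_embedding:
  assumes sg: "simple_graph H" and dist: "distinct c" and c: "set c = verts H" "length c = n"
    and e: "i < n" "i' < n" "i \<noteq> i'" and f: "j < n" "j' < n" "j \<noteq> j'"
    and edges: "edges H = cycle_edges c \<union> {{c ! i, c ! i'}, {c ! j, c ! j'}}"
    and ni: "\<not> interleaved {i, i'} {j, j'}"
  shows "\<exists>\<phi>. graph_embedding \<phi> H (hub_graph n)"
proof -
  obtain t x y where t: "x \<in> hub n" "y \<in> hub n" "(i + t) mod n = x mod n" "(j + t) mod n = y mod n"
    using hub_difference[of i n j] e f by blast
  define idx where "idx = the_inv_into {..<n} ((!) c)"
  have inj: "inj_on ((!) c) {..<n}" using dist c by (auto simp: inj_on_nth)
  have idx [simp]: "idx (c ! m) = m" if "m < n" for m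
    unfolding idx_def using the_inv_into_f_f[OF inj] that by auto
  define \<phi> where "\<phi> v = polygon_vertex n (idx v + t)" for v
  have n: "n > 0" using e by simp
  have vert: "\<exists>m<n. v = c ! m" if "v \<in> verts H" for v
    using that c by (metis in_set_conv_nth)
  have Peq: "l = m" if "polygon_vertex n (l + t) = polygon_vertex n (m + t)" "l < n" "m < n" for l m
  proof -
    have "polygon_vertex n k = polygon_vertex n (k mod n)" for k
      using n by (intro polygon_vertex_cong) auto
    then have "(l + t) mod n = (m + t) mod n"
      using that inj_onD[OF inj_on_polygon_vertex[of n], of "(l + t) mod n" "(m + t) mod n"] n by auto
    then show ?thesis using add_mod_cancel_right_less[of l t n m] that by simp
  qed
  \<comment> \<open>Translates edges of \<open>H\<close> into index pairs, so that the rest is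
    arithmetic on indices below \<open>n\<close>.\<close>
  have edge: "\<exists>a b. a < n \<and> b < n \<and> a \<noteq> b \<and> u = c ! a \<and> v = c ! b \<and>
      ((b = Suc a mod n) \<or> (a = Suc b mod n) \<or> {a, b} = {i, i'} \<or> {a, b} = {j, j'})"
    if uv: "{u, v} \<in> edges H" for u v
  proof -
    have "u \<in> verts H" "v \<in> verts H" "u \<noteq> v" using sg uv unfolding simple_graph_def by force+
    then obtain a b where ab: "a < n" "b < n" "u = c ! a" "v = c ! b" using vert by metis
    have "a \<noteq> b" using \<open>u \<noteq> v\<close> ab by auto
    have inj2: "{a, b} = {k, l}" if "{u, v} = {c ! k, c ! l}" "k < n" "l < n" for k l
      using that ab inj by (auto simp: doubleton_eq_iff inj_on_eq_iff)
    from uv edges consider k where "k < n" "{u, v} = {c ! k, c ! (Suc k mod n)}" |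
      "{u, v} = {c ! i, c ! i'}" | "{u, v} = {c ! j, c ! j'}"
      by (auto simp: cycle_edges_def c)
    then have "(b = Suc a mod n) \<or> (a = Suc b mod n) \<or> {a, b} = {i, i'} \<or> {a, b} = {j, j'}"
    proof cases
      case 1
      then have "{a, b} = {k, Suc k mod n}" using inj2 n by simp
      then show ?thesis by (auto simp: doubleton_eq_iff)
    next
      case 2
      then show ?thesis using inj2 e by simp
    next
      case 3
      then show ?thesis using inj2 f by simp
    qed
    then show ?thesis using ab \<open>a \<noteq> b\<close> by blast
  qed
  have hubE: "{polygon_vertex n k, polygon_vertex n l} \<in> edges (hub_graph n)"
    if "k \<in> hub n \<or> l = Suc k" "polygon_vertex n k \<noteq> polygon_vertex n l" for k l
    using that by (auto simp: hub_graph_def)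
  have star: "{polygon_vertex n (k + t), polygon_vertex n (l + t)} \<in> edges (hub_graph n)"
    if "k < n" "l < n" "k \<noteq> l" "(k + t) mod n = z mod n" "z \<in> hub n" for k l z
    using hubE[of z "l + t"] Peq[of k l] that polygon_vertex_cong[OF that(4) n] by auto
  have cyc: "{polygon_vertex n (k + t), polygon_vertex n (l + t)} \<in> edges (hub_graph n)"
    if "k < n" "l < n" "k \<noteq> l" "l = Suc k mod n" for k l
  proof -
    have "polygon_vertex n (l + t) = polygon_vertex n (Suc (k + t))"
      using n that(4) by (intro polygon_vertex_cong) (auto simp: mod_simps)
    then show ?thesis using hubE[of "k + t" "Suc (k + t)"] Peq[of k l] that by auto
  qed
  have "inj_on \<phi> (verts H)"
  proof (rule inj_onI)
    fix u v assume "u \<in> verts H" "v \<in> verts H" "\<phi> u = \<phi> v"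
    moreover obtain l m where "l < n" "u = c ! l" "m < n" "v = c ! m"
      using vert calculation(1,2) by metis
    ultimately show "u = v" using Peq[of l m] by (simp add: \<phi>_def)
  qed
  moreover have "\<phi> ` verts H \<subseteq> verts (hub_graph n)"
    using polygon_vertex_in_polygon[OF n] by (auto simp: \<phi>_def hub_graph_def)
  moreover have "{\<phi> u, \<phi> v} \<in> edges (hub_graph n)" if uv: "{u, v} \<in> edges H" for u v
  proof -
    obtain a b where ab: "a < n" "b < n" "a \<noteq> b" "u = c ! a" "v = c ! b"
      and or: "b = Suc a mod n \<or> a = Suc b mod n \<or> {a, b} = {i, i'} \<or> {a, b} = {j, j'}"
      using edge[OF uv] by blast
    have \<phi>: "\<phi> u = polygon_vertex n (a + t)" "\<phi> v = polygon_vertex n (b + t)"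
      using ab by (simp_all add: \<phi>_def)
    from or show ?thesis
    proof (elim disjE)
      assume "b = Suc a mod n"
      then show ?thesis using cyc[of a b] ab \<phi> by simp
    next
      assume "a = Suc b mod n"
      then show ?thesis using cyc[of b a] ab \<phi> by (simp add: insert_commute)
    next
      assume "{a, b} = {i, i'}"
      then show ?thesis using star[OF _ _ _ t(3,1), of b] star[OF _ _ _ t(3,1), of a] ab \<phi>
        by (auto simp: doubleton_eq_iff insert_commute)
    next
      assume "{a, b} = {j, j'}"
      then show ?thesis using star[OF _ _ _ t(4,2), of b] star[OF _ _ _ t(4,2), of a] ab \<phi>
        by (auto simp: doubleton_eq_iff insert_commute)
    qed
  qed
  moreover have "\<not> segments_cross (\<phi> u) (\<phi> v) (\<phi> w) (\<phi> z)"
    if uv: "{u, v} \<in> edges H" and wz: "{w, z} \<in> edges H" and ne: "{u, v} \<noteq> {w, z}" for u v w z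
  proof -
    obtain a b where ab: "a < n" "b < n" "a \<noteq> b" "u = c ! a" "v = c ! b"
      and or: "b = Suc a mod n \<or> a = Suc b mod n \<or> {a, b} = {i, i'} \<or> {a, b} = {j, j'}"
      using edge[OF uv] by blast
    obtain a' b' where ab': "a' < n" "b' < n" "a' \<noteq> b'" "w = c ! a'" "z = c ! b'"
      and or': "b' = Suc a' mod n \<or> a' = Suc b' mod n \<or> {a', b'} = {i, i'} \<or> {a', b'} = {j, j'}"
      using edge[OF wz] by blast
    have ne': "{a, b} \<noteq> {a', b'}" using ne ab ab' by (auto simp: doubleton_eq_iff)
    have sub: "{a, b} \<subseteq> {..<n}" "{a', b'} \<subseteq> {..<n}" using ab ab' by auto
    have ni': "\<not> interleaved {j, j'} {i, i'}" using ni unfolding interleaved_def by blast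
    have "\<not> interleaved {a, b} {a', b'}"
    proof -
      \<comment> \<open>Two distinct edges either include an edge of the cycle, which interleaves
        with nothing, or are the two chords.\<close>
      consider "b = Suc a mod n \<or> a = Suc b mod n" | "b' = Suc a' mod n \<or> a' = Suc b' mod n" |
        "{a, b} = {i, i'}" "{a', b'} = {j, j'}" | "{a, b} = {j, j'}" "{a', b'} = {i, i'}"
        using or or' ne' by metis
      then show ?thesis
      proof cases
        case 1
        then show ?thesis
          using cycle_edge_not_interleaved(1)[OF ab(1) sub(2)] cycle_edge_not_interleaved(1)[OF ab(2) sub(2)]
          by (auto simp: insert_commute)
      next
        case 2
        then show ?thesis
          using cycle_edge_not_interleaved(2)[OF ab'(1) sub(1)] cycle_edge_not_interleaved(2)[OF ab'(2) sub(1)]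
          by (auto simp: insert_commute)
      next
        case 3
        then show ?thesis using ni by simp
      next
        case 4
        then show ?thesis using ni' by simp
      qed
    qed
    then show ?thesis
      using polygon_chords_disjoint[OF ab(3,1,2) ab'(3,1,2) ne'] ab ab' by (simp add: \<phi>_def)
  qed
  ultimately show ?thesis unfolding graph_embedding_def by blast
qed

section \<open>Chords of an outerplanar graph in terms of indices\<close>

lemma drop_split_nth:
  assumes "i < j" "j < length c"
  shows "drop (Suc i) c = take (j - Suc i) (drop (Suc i) c) @ c ! j # drop (Suc j) c"
  using id_take_nth_drop[of "j - Suc i" "drop (Suc i) c"] assms by simp

text \<open>Rotating the cycle to start at \<open>c ! i\<close> displays the four chord ends in
  order along the list; the last segment \<open>zs\<close> wraps around through the start of
  \<open>c\<close>.\<close>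

lemma outerplanar_chords_not_interleaved:
  assumes op: "outerplanar H" and cyc: "spanning_cycle H c"
    and ch: "chord H c {c ! i, c ! k}" "chord H c {c ! j, c ! l}"
    and ord: "i < j" "j < k" "k < l" "l < length c"
  shows False
proof -
  define ws xs ys zs where "ws = take (j - Suc i) (drop (Suc i) c)" "xs = take (k - Suc j) (drop (Suc j) c)"
    "ys = take (l - Suc k) (drop (Suc k) c)" "zs = drop (Suc l) c @ take i c"
  note defs = this
  let ?L = "ws @ c ! j # xs @ c ! k # ys @ c ! l # zs"
  have "drop i c = c ! i # drop (Suc i) c" using ord by (simp add: Cons_nth_drop_Suc)
  moreover have "drop (Suc i) c = ws @ c ! j # drop (Suc j) c"
    "drop (Suc j) c = xs @ c ! k # drop (Suc k) c" "drop (Suc k) c = ys @ c ! l # drop (Suc l) c"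
    unfolding defs by (rule drop_split_nth; use ord in simp)+
  ultimately have "drop i c @ take i c = c ! i # ?L" by (simp add: defs(4))
  then have rot: "rotate i c = c ! i # ?L"
    using rotate_drop_take[of i c] ord by simp
  have sub: "path_edges (c ! i # ?L @ [c ! i]) \<subseteq> cycle_edges c"
    using path_edges_closed_subset_cycle_edges[of "c ! i" ?L] cycle_edges_rotate_subset[of i c]
    unfolding rot by (rule order_trans)
  have "distinct (rotate i c)" using cyc by (simp add: spanning_cycle_def)
  moreover have "path_edges (c ! i # ?L @ [c ! i]) \<subseteq> edges H"
    using sub cyc unfolding spanning_cycle_def by blast
  moreover have "{c ! i, c ! k} \<in> edges H" "{c ! i, c ! k} \<notin> path_edges (c ! i # ?L @ [c ! i])"
    "{c ! j, c ! l} \<in> edges H" "{c ! j, c ! l} \<notin> path_edges (c ! i # ?L @ [c ! i])"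
    using ch sub unfolding chord_def by blast+
  ultimately show False
    using outerplanar_no_interleaved_chords[OF op, of "c ! i" ws "c ! j" xs "c ! k" ys "c ! l" zs]
    unfolding rot by simp
qed

theorem theorem3:
  "\<exists>G :: nat \<Rightarrow> complex ugraph.
     (\<forall>n. convex_geometric_graph (G n) \<and> card (verts (G n)) = n \<and>
          universal_for (G n) (outerplanar_two_chords n)) \<and>
     (\<lambda>n. real (card (edges (G n)))) \<in> O(\<lambda>n. real n powr (3 / 2))"
proof (intro exI[of _ hub_graph] conjI allI)
  fix n
  show "universal_for (hub_graph n) (outerplanar_two_chords n)"
    unfolding universal_for_def
  proof
    fix H assume "H \<in> outerplanar_two_chords n"
    then have op: "outerplanar H" and n: "card (verts H) = n"
      and "\<exists>c e f. spanning_cycle H c \<and> chord H c e \<and> chord H c f \<and> e \<inter> f = {} \<and>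
        edges H = cycle_edges c \<union> {e, f}"
      unfolding outerplanar_two_chords_def by simp_all
    then obtain c e f where cyc: "spanning_cycle H c" and ch: "chord H c e" "chord H c f"
      and edges: "edges H = cycle_edges c \<union> {e, f}"
      by metis
    have sg: "simple_graph H" using op by (simp add: outerplanar_def)
    have c: "distinct c" "set c = verts H" using cyc by (simp_all add: spanning_cycle_def)
    then have len: "length c = n" using n distinct_card by metis
    obtain i i' where e: "i < length c" "i' < length c" "i \<noteq> i'" "e = {c ! i, c ! i'}"
      using chord_nth[OF sg c] ch(1) unfolding chord_def by metis
    obtain j j' where f: "j < length c" "j' < length c" "j \<noteq> j'" "f = {c ! j, c ! j'}"
      using chord_nth[OF sg c] ch(2) unfolding chord_def by metis
    have "\<not> interleaved {i, i'} {j, j'}"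
    proof
      assume "interleaved {i, i'} {j, j'}"
      then obtain p q r s where ord: "p < q" "q < r" "r < s"
        and "{i, i'} = {p, r} \<and> {j, j'} = {q, s} \<or> {i, i'} = {q, s} \<and> {j, j'} = {p, r}"
        unfolding interleaved_def by blast
      \<comment> \<open>Either chord may own the least index; the bound on \<open>s\<close> holds
        because \<open>s\<close> is one of the four chord indices.\<close>
      then have "e = {c ! p, c ! r} \<and> f = {c ! q, c ! s} \<or> f = {c ! p, c ! r} \<and> e = {c ! q, c ! s}"
        and "s < length c"
        using e f by (auto simp: doubleton_eq_iff)
      then show False
        using outerplanar_chords_not_interleaved[OF op cyc _ _ ord] ch by metis
    qed
    then show "\<exists>\<phi>. graph_embedding \<phi> H (hub_graph n)"
      using hub_graph_embedding[OF sg c len] e f edges unfolding len by blast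
  qed
qed (rule hub_graph_geometric card_verts_hub_graph card_edges_hub_graph_bigo)+

end
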